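(* Let $\Sigma=(\mathcal{A},\mathfrak{g},\{X^1,\ldots,X^n\})$ be a regular embedded noncommutative manifold and let $\{\partial_a\}_{a=1}^m$ be a hermitian basis of $\mathfrak{g}$. For any $\gamma_{a,ij}\in\mathcal{A}$ ($a=1,\ldots,m$; $i,j=1,\ldots,n$) such that $\gamma_{a,ij}^*=\gamma_{a,ji}$ and $\gamma_{a,bc}=\gamma_{c,ba}$ for all $a,b,c=1,\ldots,m$, where $\gamma_{a,bc}=\sum_{i,j=1}^n(e_b^i)^*\gamma_{a,ij}e_c^j$, the formula $$\nabla_{\partial_a}(e_bm^b)=e_b\,\partial_am^b+e_ch^{cp}\big(h^0(e_p,\partial_ae_b)+\mathrm{i}\,\gamma_{a,pb}\big)m^b$$ (summation over repeated indices $b,c,p=1,\ldots,m$; $m^b\in\mathcal{A}$), extended $\mathbb{C}$-linearly in the derivation, defines a Levi-Civita connection on $(T\Sigma,h)$. In particular, choosing $\gamma_{a,ij}=0$, there exists a Levi-Civita connection on every regular embedded noncommutative manifold.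
   Context: A Lie pair $(\mathcal{A},\mathfrak{g})$ consists of a unital $*$-algebra $\mathcal{A}$ over $\mathbb{C}$ and a complex Lie algebra $\mathfrak{g}$ of derivations of $\mathcal{A}$ that is $*$-closed: $\partial^*\in\mathfrak{g}$ for $\partial\in\mathfrak{g}$, where $\partial^*(f)=(\partial(f^* ))^*$. A derivation is hermitian if $\partial^*=\partial$; $\mathfrak{g}$ is taken to be finite-dimensional, and then has a basis $\{\partial_a\}_{a=1}^m$ of hermitian derivations. An embedded noncommutative manifold is a triple $\Sigma=(\mathcal{A},\mathfrak{g},\{X^1,\ldots,X^n\})$ with $(\mathcal{A},\mathfrak{g})$ a Lie pair and $X^1,\ldots,X^n\in\mathcal{A}$ hermitian elements. Let $\{\hat e_i\}_{i=1}^n$ be a basis of the free right module $\mathcal{A}^n$, let $\varphi:\mathfrak{g}\to\mathcal{A}^n$, $\varphi(\partial)=\sum_i\hat e_i\,\partial X^i$, and let $T\Sigma\subseteq\mathcal{A}^n$ be the right submodule generated by the image of $\varphi$. Write $e_a=\varphi(\partial_a)$, $e_a^i=\partial_aX^i$, and $\partial_ae_b=\sum_i\hat e_i\,\partial_a\partial_bX^i$. Let $h^0(U,V)=\sum_{i=1}^n(U^i)^*V^i$ for $U=\sum_i\hat e_iU^i$, $V=\sum_i\hat e_iV^i$, let $h=h^0|_{T\Sigma}$ and $h_{ab}=h(e_a,e_b)$. A hermitian form on a right $\mathcal{A}$-module $M$ is a map $h:M\times M\to\mathcal{A}$ with $h(m_1,m_2)^*=h(m_2,m_1)$, $h(m_1,m_2a)=h(m_1,m_2)a$,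 and additive in the first argument; it is invertible if $m_1\mapsto h(m_1,\cdot)$ is a bijection from $M$ onto the dual module $M^*$ of right module homomorphisms $M\to\mathcal{A}$; $(M,h)$ is a regular hermitian module if $M$ is finitely generated projective and $h$ is invertible. $\Sigma$ is regular if $(T\Sigma,h)$ is a regular hermitian module; in that case there exist $h^{ab}\in\mathcal{A}$ ($a,b=1,\ldots,m$) with $\sum_{a,b}e_ah^{ab}h_{bc}=e_c$ for $c=1,\ldots,m$, and $h^{ab}$ denotes such elements. A connection on $T\Sigma$ is a map $\nabla:\mathfrak{g}\times T\Sigma\to T\Sigma$, additive in $T\Sigma$, $\mathbb{C}$-linear in $\mathfrak{g}$, with $\nabla_\partial(ma)=(\nabla_\partial m)a+m\,\partial(a)$. It is hermitian if $\partial h(m_1,m_2)=h(\nabla_{\partial^*}m_1,m_2)+h(m_1,\nabla_\partial m_2)$ for all $m_1,m_2\in T\Sigma$, $\partial\in\mathfrak{g}$; torsion free if $\nabla_{\partial_1}\varphi(\partial_2)-\nabla_{\partial_2}\varphi(\partial_1)=\varphi([\partial_1,\partial_2])$ for all $\partial_1,\partial_2\in\mathfrak{g}$; and a Levi-Civita connection if it is both hermitian and torsion free. *)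

theory Defs
  imports Complex_Main "HOL-Library.Function_Algebras" "HOL-Library.FuncSet"
begin

(* The sort {ring, monoid_mult} is that of unital associative rings in which 0 = 1 is not
   excluded; the class ring_1 would rule out the zero algebra. *)

locale star_algebra = vector_space scale
  for scale :: "complex \<Rightarrow> 'a::{ring,monoid_mult} \<Rightarrow> 'a" +
  fixes star :: "'a \<Rightarrow> 'a"
  assumes scale_mult_left: "scale c x * y = scale c (x * y)"
    and scale_mult_right: "x * scale c y = scale c (x * y)"
    and star_add: "star (x + y) = star x + star y"
    and star_scale: "star (scale c x) = scale (cnj c) (star x)"
    and star_mult: "star (x * y) = star y * star x"
    and star_star: "star (star x) = x"


section \<open>Lie pairs\<close>

(* Pointwise scaling of functions into the algebra; used both for derivations ('i = 'a) and for
   the elements of the free modules below. Addition of functions is the pointwise one of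
   Function_Algebras. *)
definition fun_scale :: "(complex \<Rightarrow> 'a \<Rightarrow> 'a) \<Rightarrow> complex \<Rightarrow> ('i \<Rightarrow> 'a) \<Rightarrow> 'i \<Rightarrow> 'a" where
  "fun_scale scale c f = (\<lambda>x. scale c (f x))"

definition derivation ::
    "(complex \<Rightarrow> 'a \<Rightarrow> 'a) \<Rightarrow> ('a::{ring,monoid_mult} \<Rightarrow> 'a) \<Rightarrow> bool" where
  "derivation scale d \<longleftrightarrow>
     Vector_Spaces.linear scale scale d \<and> (\<forall>x y. d (x * y) = d x * y + x * d y)"

definition lie_bracket :: "('a::ab_group_add \<Rightarrow> 'a) \<Rightarrow> ('a \<Rightarrow> 'a) \<Rightarrow> 'a \<Rightarrow> 'a" where
  "lie_bracket d1 d2 = (\<lambda>x. d1 (d2 x) - d2 (d1 x))"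

definition der_star :: "('a \<Rightarrow> 'a) \<Rightarrow> ('a \<Rightarrow> 'a) \<Rightarrow> 'a \<Rightarrow> 'a" where
  "der_star star d = (\<lambda>x. star (d (star x)))"

locale lie_pair = star_algebra scale star
  for scale :: "complex \<Rightarrow> 'a::{ring,monoid_mult} \<Rightarrow> 'a" and star :: "'a \<Rightarrow> 'a" +
  fixes g :: "('a \<Rightarrow> 'a) set"
  assumes derivation: "d \<in> g \<Longrightarrow> derivation scale d"
    and subspace: "module.subspace (fun_scale scale) g"
    and bracket_closed: "d1 \<in> g \<Longrightarrow> d2 \<in> g \<Longrightarrow> lie_bracket d1 d2 \<in> g"
    and der_star_closed: "d \<in> g \<Longrightarrow> der_star star d \<in> g"
    and finite_dimensional: "\<exists>B. finite B \<and> module.span (fun_scale scale) B = g"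

definition hermitian_basis ::
    "(complex \<Rightarrow> 'a::{ring,monoid_mult} \<Rightarrow> 'a) \<Rightarrow> ('a \<Rightarrow> 'a) \<Rightarrow> ('a \<Rightarrow> 'a) set \<Rightarrow>
     nat \<Rightarrow> (nat \<Rightarrow> 'a \<Rightarrow> 'a) \<Rightarrow> bool" where
  "hermitian_basis scale star g m D \<longleftrightarrow>
     inj_on D {1..m} \<and>
     \<not> module.dependent (fun_scale scale) (D ` {1..m}) \<and>
     module.span (fun_scale scale) (D ` {1..m}) = g \<and>
     (\<forall>a\<in>{1..m}. der_star star (D a) = D a)"


section \<open>Right modules over a noncommutative ring\<close>

(* Modules are subsets M of an abelian group type, with a right action of the whole ring type. *)

definition right_module ::
    "('b::ab_group_add \<Rightarrow> 'a::{ring,monoid_mult} \<Rightarrow> 'b) \<Rightarrow> 'b set \<Rightarrow> bool" where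
  "right_module act M \<longleftrightarrow>
     0 \<in> M \<and> (\<forall>x\<in>M. \<forall>y\<in>M. x + y \<in> M) \<and> (\<forall>x\<in>M. - x \<in> M) \<and>
     (\<forall>x\<in>M. \<forall>a. act x a \<in> M) \<and>
     (\<forall>x\<in>M. \<forall>y\<in>M. \<forall>a. act (x + y) a = act x a + act y a) \<and>
     (\<forall>x\<in>M. \<forall>a b. act x (a + b) = act x a + act x b) \<and>
     (\<forall>x\<in>M. \<forall>a b. act x (a * b) = act (act x a) b) \<and>
     (\<forall>x\<in>M. act x 1 = x)"

definition right_submodule ::
    "('b::ab_group_add \<Rightarrow> 'a::{ring,monoid_mult} \<Rightarrow> 'b) \<Rightarrow> 'b set \<Rightarrow> 'b set \<Rightarrow> bool" where
  "right_submodule act M N \<longleftrightarrow> N \<subseteq> M \<and> right_module act N"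

definition right_hom ::
    "('b::ab_group_add \<Rightarrow> 'a::{ring,monoid_mult} \<Rightarrow> 'b) \<Rightarrow> 'b set \<Rightarrow>
     ('c::ab_group_add \<Rightarrow> 'a \<Rightarrow> 'c) \<Rightarrow> 'c set \<Rightarrow> ('b \<Rightarrow> 'c) \<Rightarrow> bool" where
  "right_hom act M act' N f \<longleftrightarrow>
     f \<in> M \<rightarrow> N \<and> (\<forall>x\<in>M. \<forall>y\<in>M. f (x + y) = f x + f y) \<and>
     (\<forall>x\<in>M. \<forall>a. f (act x a) = act' (f x) a)"

(* Functionals are represented by their extensional versions, so that equality of functionals
   is equality on M. *)
definition right_dual ::
    "('b::ab_group_add \<Rightarrow> 'a::{ring,monoid_mult} \<Rightarrow> 'b) \<Rightarrow> 'b set \<Rightarrow> ('b \<Rightarrow> 'a) set" where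
  "right_dual act M = {f \<in> extensional M. right_hom act M (*) UNIV f}"

definition vec_act :: "('i \<Rightarrow> 'a::{ring,monoid_mult}) \<Rightarrow> 'a \<Rightarrow> 'i \<Rightarrow> 'a"  (infixl "\<cdot>" 70) where
  "U \<cdot> a = (\<lambda>i. U i * a)"

(* The free right module on the index set I, as coefficient families with finite support in I;
   in particular A^n is free_module {1..n}. *)
definition free_module :: "'i set \<Rightarrow> ('i \<Rightarrow> 'a::{ring,monoid_mult}) set" where
  "free_module I = {U. finite {i. U i \<noteq> 0} \<and> (\<forall>i. i \<notin> I \<longrightarrow> U i = 0)}"

definition finitely_generated ::
    "('b::ab_group_add \<Rightarrow> 'a::{ring,monoid_mult} \<Rightarrow> 'b) \<Rightarrow> 'b set \<Rightarrow> bool" where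
  "finitely_generated act M \<longleftrightarrow> (\<exists>S. finite S \<and> S \<subseteq> M \<and> right_submodule act M hull S = M)"

(* M is isomorphic to a direct summand P of a free module. Taking index sets I in the element
   type of M loses nothing: M is a quotient of the free module on the set M, and a direct summand
   of that free module as soon as it is a direct summand of any free module. *)
definition projective ::
    "('b::ab_group_add \<Rightarrow> 'a::{ring,monoid_mult} \<Rightarrow> 'b) \<Rightarrow> 'b set \<Rightarrow> bool" where
  "projective act M \<longleftrightarrow>
     (\<exists>(I :: 'b set) (P :: ('b \<Rightarrow> 'a) set) Q f.
        right_submodule vec_act (free_module I) P \<and> right_submodule vec_act (free_module I) Q \<and>
        P \<inter> Q = {0} \<and> (\<forall>U\<in>free_module I. \<exists>p\<in>P. \<exists>q\<in>Q. U = p + q) \<and>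
        right_hom act M vec_act P f \<and> bij_betw f M P)"

definition hermitian_form ::
    "('a \<Rightarrow> 'a) \<Rightarrow> ('b::ab_group_add \<Rightarrow> 'a::{ring,monoid_mult} \<Rightarrow> 'b) \<Rightarrow> 'b set \<Rightarrow>
     ('b \<Rightarrow> 'b \<Rightarrow> 'a) \<Rightarrow> bool" where
  "hermitian_form star act M h \<longleftrightarrow>
     (\<forall>x\<in>M. \<forall>y\<in>M. star (h x y) = h y x) \<and>
     (\<forall>x\<in>M. \<forall>y\<in>M. \<forall>a. h x (act y a) = h x y * a) \<and>
     (\<forall>x\<in>M. \<forall>y\<in>M. \<forall>z\<in>M. h (x + y) z = h x z + h y z)"

definition invertible_form ::
    "('b::ab_group_add \<Rightarrow> 'a::{ring,monoid_mult} \<Rightarrow> 'b) \<Rightarrow> 'b set \<Rightarrow> ('b \<Rightarrow> 'b \<Rightarrow> 'a) \<Rightarrow> bool" where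
  "invertible_form act M h \<longleftrightarrow> bij_betw (\<lambda>x. restrict (h x) M) M (right_dual act M)"

definition regular_hermitian_module ::
    "('a \<Rightarrow> 'a) \<Rightarrow> ('b::ab_group_add \<Rightarrow> 'a::{ring,monoid_mult} \<Rightarrow> 'b) \<Rightarrow> 'b set \<Rightarrow>
     ('b \<Rightarrow> 'b \<Rightarrow> 'a) \<Rightarrow> bool" where
  "regular_hermitian_module star act M h \<longleftrightarrow>
     right_module act M \<and> hermitian_form star act M h \<and>
     finitely_generated act M \<and> projective act M \<and> invertible_form act M h"


section \<open>Embedded noncommutative manifolds\<close>

(* Only the values X 1, ..., X n matter. *)
locale embedded_manifold = lie_pair scale star g
  for scale :: "complex \<Rightarrow> 'a::{ring,monoid_mult} \<Rightarrow> 'a" and star :: "'a \<Rightarrow> 'a"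
    and g :: "('a \<Rightarrow> 'a) set" +
  fixes n :: nat and X :: "nat \<Rightarrow> 'a"
  assumes X_hermitian: "i \<in> {1..n} \<Longrightarrow> star (X i) = X i"

definition phi :: "nat \<Rightarrow> (nat \<Rightarrow> 'a) \<Rightarrow> ('a \<Rightarrow> 'a) \<Rightarrow> nat \<Rightarrow> 'a::{ring,monoid_mult}" where
  "phi n X d = (\<lambda>i. if i \<in> {1..n} then d (X i) else 0)"

definition tangent ::
    "('a \<Rightarrow> 'a) set \<Rightarrow> nat \<Rightarrow> (nat \<Rightarrow> 'a) \<Rightarrow> (nat \<Rightarrow> 'a::{ring,monoid_mult}) set" where
  "tangent g n X = right_submodule vec_act (free_module {1..n}) hull (phi n X ` g)"

definition h0 :: "('a \<Rightarrow> 'a) \<Rightarrow> nat \<Rightarrow> (nat \<Rightarrow> 'a) \<Rightarrow> (nat \<Rightarrow> 'a) \<Rightarrow> 'a::{ring,monoid_mult}" where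
  "h0 star n U V = (\<Sum>i=1..n. star (U i) * V i)"

definition regular_manifold ::
    "('a \<Rightarrow> 'a) \<Rightarrow> ('a \<Rightarrow> 'a) set \<Rightarrow> nat \<Rightarrow> (nat \<Rightarrow> 'a::{ring,monoid_mult}) \<Rightarrow> bool" where
  "regular_manifold star g n X \<longleftrightarrow>
     regular_hermitian_module star vec_act (tangent g n X) (h0 star n)"


section \<open>Connections on the tangent module\<close>

(* Values nabla d U with d outside g or U outside the tangent module are junk. *)

definition linear_in_derivation ::
    "(complex \<Rightarrow> 'a \<Rightarrow> 'a) \<Rightarrow> ('a \<Rightarrow> 'a) set \<Rightarrow> nat \<Rightarrow> (nat \<Rightarrow> 'a::{ring,monoid_mult}) \<Rightarrow>
     (('a \<Rightarrow> 'a) \<Rightarrow> (nat \<Rightarrow> 'a) \<Rightarrow> nat \<Rightarrow> 'a) \<Rightarrow> bool" where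
  "linear_in_derivation scale g n X nabla \<longleftrightarrow>
     (\<forall>d1\<in>g. \<forall>d2\<in>g. \<forall>U\<in>tangent g n X. nabla (d1 + d2) U = nabla d1 U + nabla d2 U) \<and>
     (\<forall>c. \<forall>d\<in>g. \<forall>U\<in>tangent g n X. nabla (fun_scale scale c d) U = fun_scale scale c (nabla d U))"

definition connection ::
    "(complex \<Rightarrow> 'a \<Rightarrow> 'a) \<Rightarrow> ('a \<Rightarrow> 'a) set \<Rightarrow> nat \<Rightarrow> (nat \<Rightarrow> 'a::{ring,monoid_mult}) \<Rightarrow>
     (('a \<Rightarrow> 'a) \<Rightarrow> (nat \<Rightarrow> 'a) \<Rightarrow> nat \<Rightarrow> 'a) \<Rightarrow> bool" where
  "connection scale g n X nabla \<longleftrightarrow>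
     (\<forall>d\<in>g. \<forall>U\<in>tangent g n X. nabla d U \<in> tangent g n X) \<and>
     (\<forall>d\<in>g. \<forall>U\<in>tangent g n X. \<forall>V\<in>tangent g n X. nabla d (U + V) = nabla d U + nabla d V) \<and>
     linear_in_derivation scale g n X nabla \<and>
     (\<forall>d\<in>g. \<forall>U\<in>tangent g n X. \<forall>a. nabla d (U \<cdot> a) = nabla d U \<cdot> a + U \<cdot> d a)"

definition hermitian_connection ::
    "('a \<Rightarrow> 'a) \<Rightarrow> ('a \<Rightarrow> 'a) set \<Rightarrow> nat \<Rightarrow> (nat \<Rightarrow> 'a::{ring,monoid_mult}) \<Rightarrow>
     (('a \<Rightarrow> 'a) \<Rightarrow> (nat \<Rightarrow> 'a) \<Rightarrow> nat \<Rightarrow> 'a) \<Rightarrow> bool" where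
  "hermitian_connection star g n X nabla \<longleftrightarrow>
     (\<forall>d\<in>g. \<forall>U\<in>tangent g n X. \<forall>V\<in>tangent g n X.
        d (h0 star n U V) = h0 star n (nabla (der_star star d) U) V + h0 star n U (nabla d V))"

definition torsion_free ::
    "('a \<Rightarrow> 'a) set \<Rightarrow> nat \<Rightarrow> (nat \<Rightarrow> 'a::{ring,monoid_mult}) \<Rightarrow>
     (('a \<Rightarrow> 'a) \<Rightarrow> (nat \<Rightarrow> 'a) \<Rightarrow> nat \<Rightarrow> 'a) \<Rightarrow> bool" where
  "torsion_free g n X nabla \<longleftrightarrow>
     (\<forall>d1\<in>g. \<forall>d2\<in>g.
        nabla d1 (phi n X d2) - nabla d2 (phi n X d1) = phi n X (lie_bracket d1 d2))"

definition levi_civita ::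
    "(complex \<Rightarrow> 'a \<Rightarrow> 'a) \<Rightarrow> ('a \<Rightarrow> 'a) \<Rightarrow> ('a \<Rightarrow> 'a) set \<Rightarrow> nat \<Rightarrow>
     (nat \<Rightarrow> 'a::{ring,monoid_mult}) \<Rightarrow> (('a \<Rightarrow> 'a) \<Rightarrow> (nat \<Rightarrow> 'a) \<Rightarrow> nat \<Rightarrow> 'a) \<Rightarrow> bool" where
  "levi_civita scale star g n X nabla \<longleftrightarrow>
     connection scale g n X nabla \<and> hermitian_connection star g n X nabla \<and>
     torsion_free g n X nabla"


section \<open>The connections determined by a hermitian basis\<close>

(* In this section e b = phi n X (D b), for a family of derivations D. *)

definition metric_inverse ::
    "('a \<Rightarrow> 'a) \<Rightarrow> nat \<Rightarrow> nat \<Rightarrow> (nat \<Rightarrow> nat \<Rightarrow> 'a) \<Rightarrow> (nat \<Rightarrow> nat \<Rightarrow> 'a::{ring,monoid_mult}) \<Rightarrow> bool" where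
  "metric_inverse star n m e hinv \<longleftrightarrow>
     (\<forall>c\<in>{1..m}. (\<Sum>a=1..m. \<Sum>b=1..m. e a \<cdot> (hinv a b * h0 star n (e b) (e c))) = e c)"

definition gamma_comp ::
    "('a \<Rightarrow> 'a) \<Rightarrow> nat \<Rightarrow> (nat \<Rightarrow> nat \<Rightarrow> 'a) \<Rightarrow> (nat \<Rightarrow> nat \<Rightarrow> nat \<Rightarrow> 'a) \<Rightarrow>
     nat \<Rightarrow> nat \<Rightarrow> nat \<Rightarrow> 'a::{ring,monoid_mult}" where
  "gamma_comp star n e \<gamma> a b c = (\<Sum>i=1..n. \<Sum>j=1..n. star (e b i) * \<gamma> a i j * e c j)"

(* The vector with components D a (e b i), i.e. D a (D b (X i)) for i in {1..n}, is D a \<circ> e b. *)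
definition connection_formula ::
    "(complex \<Rightarrow> 'a \<Rightarrow> 'a) \<Rightarrow> ('a \<Rightarrow> 'a) \<Rightarrow> nat \<Rightarrow> nat \<Rightarrow> (nat \<Rightarrow> 'a \<Rightarrow> 'a) \<Rightarrow>
     (nat \<Rightarrow> nat \<Rightarrow> 'a) \<Rightarrow> (nat \<Rightarrow> nat \<Rightarrow> 'a) \<Rightarrow> (nat \<Rightarrow> nat \<Rightarrow> nat \<Rightarrow> 'a) \<Rightarrow>
     (('a \<Rightarrow> 'a) \<Rightarrow> (nat \<Rightarrow> 'a) \<Rightarrow> nat \<Rightarrow> 'a::{ring,monoid_mult}) \<Rightarrow> bool" where
  "connection_formula scale star n m D e hinv \<gamma> nabla \<longleftrightarrow>
     (\<forall>a\<in>{1..m}. \<forall>\<mu> :: nat \<Rightarrow> 'a.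
        nabla (D a) (\<Sum>b=1..m. e b \<cdot> \<mu> b) =
          (\<Sum>b=1..m. e b \<cdot> D a (\<mu> b)) +
          (\<Sum>b=1..m. \<Sum>c=1..m. \<Sum>p=1..m.
             e c \<cdot> (hinv c p *
               (h0 star n (e p) (D a \<circ> e b) + scale \<i> (gamma_comp star n e \<gamma> a p b)) * \<mu> b)))"

end

theory Submission imports Defs begin

text \<open>
  Invertibility of the form on the tangent module T yields an orthogonal projection P from A^n
  onto T, and the metric inverse expresses it as P U = e_c h^(cp) h^0(e_p, U). Hence the
  connection of the theorem is U \<mapsto> P (\<partial>U + i \<gamma>(\<partial>) U), where \<partial> acts
  componentwise and \<gamma>(\<partial>) is the matrix \<gamma> extended linearly in \<partial>. This
  expression does not refer to a representation of U by generators, so it is well defined. It is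
  hermitian because P is self-adjoint and \<gamma> is hermitian, and torsion free because P fixes
  \<phi>([\<partial>, \<partial>']) and P \<gamma>(\<partial>) \<phi>(\<partial>') is symmetric in
  \<partial> and \<partial>'.
\<close>

section \<open>Vectors over the algebra, matrices acting on them, and the right action\<close>

lemma sum_fun_apply: "(\<Sum>b\<in>B. f b) x = (\<Sum>b\<in>B. f b x)"
  by (induction B rule: infinite_finite_induct) auto

definition mat_act :: "nat \<Rightarrow> (nat \<Rightarrow> nat \<Rightarrow> 'a) \<Rightarrow> (nat \<Rightarrow> 'a) \<Rightarrow> nat \<Rightarrow> 'a::{ring,monoid_mult}" where
  "mat_act n M U = (\<lambda>i. \<Sum>j=1..n. M i j * U j)"

lemma mat_act_add_left: "mat_act n (\<lambda>i j. M i j + N i j) U = mat_act n M U + mat_act n N U"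
  by (simp add: mat_act_def fun_eq_iff distrib_right sum.distrib)

lemma mat_act_add_right: "mat_act n M (U + V) = mat_act n M U + mat_act n M V"
  by (simp add: mat_act_def fun_eq_iff distrib_left sum.distrib)

lemma mat_act_zero_right: "mat_act n M 0 = 0"
  by (simp add: mat_act_def fun_eq_iff)

lemma mat_act_vec_act: "mat_act n M (U \<cdot> a) = mat_act n M U \<cdot> a"
  by (simp add: mat_act_def vec_act_def fun_eq_iff sum_distrib_right mult.assoc)

lemma mat_act_sum_right: "mat_act n M (\<Sum>b\<in>B. U b) = (\<Sum>b\<in>B. mat_act n M (U b))"
  using sum_comp_morphism[of "mat_act n M" U B, OF mat_act_zero_right mat_act_add_right]
  by (simp add: comp_def)

text \<open>This rewriting turns the symmetry condition on \<gamma> into a condition on pairings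
  with the generators, the only data that the orthogonal projection sees.\<close>

lemma gamma_comp_eq_h0: "gamma_comp star n e \<gamma> a b c = h0 star n (e b) (mat_act n (\<gamma> a) (e c))"
  by (simp add: gamma_comp_def h0_def mat_act_def sum_distrib_left mult.assoc)

lemma vec_act_add_left: "(U + V) \<cdot> a = U \<cdot> a + V \<cdot> a"
  by (simp add: vec_act_def fun_eq_iff distrib_right)

lemma vec_act_add_right: "U \<cdot> (a + b) = U \<cdot> a + U \<cdot> b"
  by (simp add: vec_act_def fun_eq_iff distrib_left)

lemma vec_act_assoc: "U \<cdot> a \<cdot> b = U \<cdot> (a * b)"
  by (simp add: vec_act_def fun_eq_iff mult.assoc)

lemma vec_act_sum_left: "(\<Sum>b\<in>B. U b) \<cdot> a = (\<Sum>b\<in>B. U b \<cdot> a)"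
  by (simp add: vec_act_def fun_eq_iff sum_fun_apply sum_distrib_right)

lemma vec_act_sum_right: "U \<cdot> (\<Sum>b\<in>B. a b) = (\<Sum>b\<in>B. U \<cdot> a b)"
  by (simp add: vec_act_def fun_eq_iff sum_fun_apply sum_distrib_left)

text \<open>Over a finite index set the finiteness of the support is automatic.\<close>

lemma free_module_finite:
  fixes I :: "'i set"
  assumes "finite I"
  shows "free_module I = {U. \<forall>i. i \<notin> I \<longrightarrow> U i = (0::'b::{ring,monoid_mult})}"
proof -
  have "finite {i. U i \<noteq> 0}" if "\<forall>i. i \<notin> I \<longrightarrow> U i = 0" for U :: "'i \<Rightarrow> 'b::{ring,monoid_mult}"
    using that by (intro finite_subset[OF _ assms]) auto
  then show ?thesis
    unfolding free_module_def by blast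
qed

section \<open>The involution and the sesquilinearity of \<open>h0\<close>\<close>

context star_algebra
begin

lemma star_zero: "star 0 = 0"
  using star_add[of 0 0] by simp

lemma star_sum: "star (\<Sum>b\<in>B. f b) = (\<Sum>b\<in>B. star (f b))"
  by (induction B rule: infinite_finite_induct) (auto simp: star_zero star_add)

lemma vector_space_fun_scale: "vector_space (fun_scale scale)"
  by unfold_locales (auto simp: fun_scale_def fun_eq_iff scale_right_distrib scale_left_distrib)

text \<open>Complex scaling is a special right action, so right submodules are closed under it and
  maps compatible with the right action respect it.\<close>

lemma fun_scale_eq_vec_act: "fun_scale scale c U = U \<cdot> scale c 1"
  by (simp add: fun_scale_def vec_act_def fun_eq_iff scale_mult_right)

lemma fun_scale_add: "fun_scale scale c (U + V) = fun_scale scale c U + fun_scale scale c V"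
  by (simp add: fun_scale_def fun_eq_iff scale_right_distrib)

lemma vec_act_fun_scale: "fun_scale scale c U \<cdot> a = fun_scale scale c (U \<cdot> a)"
  by (simp add: fun_scale_def vec_act_def fun_eq_iff scale_mult_left)

lemma mat_act_fun_scale: "mat_act n M (fun_scale scale c U) = fun_scale scale c (mat_act n M U)"
  by (simp add: mat_act_def fun_scale_def fun_eq_iff scale_mult_right scale_sum_right)

lemma mat_act_scale_left:
  "mat_act n (\<lambda>i j. scale c (M i j)) U = fun_scale scale c (mat_act n M U)"
  by (simp add: mat_act_def fun_scale_def fun_eq_iff scale_mult_left scale_sum_right)

lemma star_h0: "star (h0 star n U V) = h0 star n V U"
  by (simp add: h0_def star_sum star_mult star_star)

lemma h0_add_right: "h0 star n U (V + W) = h0 star n U V + h0 star n U W"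
  by (simp add: h0_def distrib_left sum.distrib)

lemma h0_add_left: "h0 star n (U + V) W = h0 star n U W + h0 star n V W"
  by (simp add: h0_def star_add distrib_right sum.distrib)

lemma h0_vec_act_right: "h0 star n U (V \<cdot> a) = h0 star n U V * a"
  by (simp add: h0_def vec_act_def sum_distrib_right mult.assoc)

lemma h0_vec_act_left: "h0 star n (U \<cdot> a) V = star a * h0 star n U V"
  by (simp add: h0_def vec_act_def sum_distrib_left mult.assoc star_mult)

lemma h0_scale_right: "h0 star n U (fun_scale scale c V) = scale c (h0 star n U V)"
  by (simp add: h0_def fun_scale_def scale_mult_right scale_sum_right)

lemma h0_scale_left: "h0 star n (fun_scale scale c U) V = scale (cnj c) (h0 star n U V)"
  by (simp add: h0_def fun_scale_def scale_mult_left scale_sum_right star_scale)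

lemma h0_zero_right: "h0 star n U 0 = 0"
  by (simp add: h0_def)

lemma h0_zero_left: "h0 star n 0 U = 0"
  by (simp add: h0_def star_zero)

lemma h0_sum_right: "h0 star n U (\<Sum>b\<in>B. V b) = (\<Sum>b\<in>B. h0 star n U (V b))"
  using sum_comp_morphism[of "h0 star n U" V B, OF h0_zero_right h0_add_right]
  by (simp add: comp_def)

lemma h0_sum_left: "h0 star n (\<Sum>b\<in>B. V b) U = (\<Sum>b\<in>B. h0 star n (V b) U)"
  using sum_comp_morphism[of "\<lambda>W. h0 star n W U" V B, OF h0_zero_left h0_add_left]
  by (simp add: comp_def)

text \<open>The adjoint of a matrix is its entrywise starred transpose. Only entries with indices in
  \<open>{1..n}\<close> enter the sums.\<close>

lemma h0_mat_act_adjoint: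
  assumes "\<forall>i\<in>{1..n}. \<forall>j\<in>{1..n}. star (M i j) = N j i"
  shows "h0 star n (mat_act n M U) V = h0 star n U (mat_act n N V)"
proof -
  have "h0 star n (mat_act n M U) V = (\<Sum>i=1..n. \<Sum>j=1..n. star (U j) * (N j i * V i))"
    using assms
    by (simp add: h0_def mat_act_def star_sum star_mult sum_distrib_right mult.assoc)
  also have "\<dots> = (\<Sum>j=1..n. \<Sum>i=1..n. star (U j) * (N j i * V i))"
    by (rule sum.swap)
  finally show ?thesis
    by (simp add: h0_def mat_act_def sum_distrib_left)
qed

lemma der_star_add: "der_star star (d1 + d2) = der_star star d1 + der_star star d2"
  by (simp add: der_star_def fun_eq_iff star_add)

lemma der_star_fun_scale:
  "der_star star (fun_scale scale c d) = fun_scale scale (cnj c) (der_star star d)"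
  by (simp add: der_star_def fun_scale_def fun_eq_iff star_scale)

end

section \<open>Derivations acting componentwise, and induction over a hermitian basis\<close>

context lie_pair
begin

sublocale pw: vector_space "fun_scale scale :: complex \<Rightarrow> ('i \<Rightarrow> 'a) \<Rightarrow> 'i \<Rightarrow> 'a"
  by (rule vector_space_fun_scale)

lemma zero_in_g: "0 \<in> g"
  and add_in_g: "d1 \<in> g \<Longrightarrow> d2 \<in> g \<Longrightarrow> d1 + d2 \<in> g"
  and scale_in_g: "d \<in> g \<Longrightarrow> fun_scale scale c d \<in> g"
  using subspace by (auto simp: pw.subspace_def)

lemma
  assumes "d \<in> g"
  shows der_add: "d (x + y) = d x + d y"
    and der_mult: "d (x * y) = d x * y + x * d y"
    and der_zero: "d 0 = 0"
    and der_sum: "d (\<Sum>b\<in>B. f b) = (\<Sum>b\<in>B. d (f b))"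
proof -
  have lin: "Vector_Spaces.linear scale scale d" and mult: "\<And>x y. d (x * y) = d x * y + x * d y"
    using derivation[OF assms] by (auto simp: derivation_def)
  interpret d: Vector_Spaces.linear scale scale d by (rule lin)
  show "d (x + y) = d x + d y" "d (x * y) = d x * y + x * d y"
    "d 0 = 0" "d (\<Sum>b\<in>B. f b) = (\<Sum>b\<in>B. d (f b))"
    by (simp_all add: d.add mult d.zero d.sum)
qed

lemma comp_add_right: "d \<in> g \<Longrightarrow> d \<circ> (U + V) = (d \<circ> U) + (d \<circ> V)"
  by (simp add: fun_eq_iff der_add)

lemma comp_vec_act: "d \<in> g \<Longrightarrow> d \<circ> (U \<cdot> a) = (d \<circ> U) \<cdot> a + U \<cdot> d a"
  by (simp add: fun_eq_iff vec_act_def der_mult)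

lemma comp_sum: "d \<in> g \<Longrightarrow> d \<circ> (\<Sum>b\<in>B. U b) = (\<Sum>b\<in>B. d \<circ> U b)"
  by (simp add: fun_eq_iff sum_fun_apply der_sum)

lemma phi_add: "phi n X (d1 + d2) = phi n X d1 + phi n X d2"
  by (simp add: phi_def fun_eq_iff)

lemma phi_scale: "phi n X (fun_scale scale c d) = fun_scale scale c (phi n X d)"
  by (simp add: phi_def fun_scale_def fun_eq_iff)

lemma phi_lie_bracket:
  assumes "d1 \<in> g" "d2 \<in> g"
  shows "phi n X (lie_bracket d1 d2) = (d1 \<circ> phi n X d2) - (d2 \<circ> phi n X d1)"
  \<comment> \<open>Outside \<open>{1..n}\<close> the components of \<open>phi\<close> are 0, and
    \<open>der_zero\<close> keeps them 0 after differentiation.\<close>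
  using assms by (simp add: phi_def lie_bracket_def fun_eq_iff der_zero)

text \<open>This is the Leibniz rule in each summand:
  \<open>d (star u) = star (der_star star d u)\<close> by the definition of \<open>der_star\<close>.
  It is the hermiticity of the componentwise derivative, before projecting.\<close>

lemma h0_derivation:
  assumes "d \<in> g"
  shows "d (h0 star n U V) = h0 star n (der_star star d \<circ> U) V + h0 star n U (d \<circ> V)"
  using assms
  by (simp add: h0_def der_sum der_mult der_star_def star_star sum.distrib)

lemma hermitian_basis_in:
  assumes "hermitian_basis scale star g m D" "a \<in> {1..m}"
  shows "D a \<in> g"
  using assms pw.span_superset[of "D ` {1..m}"] by (auto simp: hermitian_basis_def)

text \<open>The derivations in \<open>g\<close> satisfying \<open>P\<close> form a subspace
  containing the basis, hence all of its span.\<close>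

lemma hermitian_basis_induct:
  assumes "hermitian_basis scale star g m D" "d \<in> g"
    and zero: "P 0"
    and add: "\<And>x y. x \<in> g \<Longrightarrow> y \<in> g \<Longrightarrow> P x \<Longrightarrow> P y \<Longrightarrow> P (x + y)"
    and scale: "\<And>c x. x \<in> g \<Longrightarrow> P x \<Longrightarrow> P (fun_scale scale c x)"
    and base: "\<And>a. a \<in> {1..m} \<Longrightarrow> P (D a)"
  shows "P d"
proof -
  have "pw.span (D ` {1..m}) \<subseteq> {x \<in> g. P x}"
  proof (rule pw.span_minimal)
    show "D ` {1..m} \<subseteq> {x \<in> g. P x}"
      using hermitian_basis_in[OF assms(1)] base by auto
    show "pw.subspace {x \<in> g. P x}"
      using zero add scale zero_in_g add_in_g scale_in_g by (auto simp: pw.subspace_def)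
  qed
  then show ?thesis
    using assms(1,2) by (auto simp: hermitian_basis_def)
qed

end

section \<open>The orthogonal projection onto the tangent module\<close>

locale regular_embedded_manifold = embedded_manifold +
  assumes regular: "regular_manifold star g n X"
begin

abbreviation T where "T \<equiv> tangent g n X"

abbreviation h where "h \<equiv> h0 star n"

lemma T_module: "right_module vec_act T"
  and T_invertible: "invertible_form vec_act T h"
  using regular by (simp_all add: regular_manifold_def regular_hermitian_module_def)

lemma T_add: "U \<in> T \<Longrightarrow> V \<in> T \<Longrightarrow> U + V \<in> T"
  and T_vec_act: "U \<in> T \<Longrightarrow> U \<cdot> a \<in> T"
  using T_module by (simp_all add: right_module_def)

lemma phi_in_T: "d \<in> g \<Longrightarrow> phi n X d \<in> T"
  unfolding tangent_def using hull_subset[of "phi n X ` g"] by blast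

text \<open>Injectivity of the map from \<open>T\<close> to its dual makes the form nondegenerate on
  \<open>T\<close>.\<close>

lemma tangent_eqI:
  assumes "U \<in> T" "V \<in> T" "\<And>W. W \<in> T \<Longrightarrow> h U W = h V W"
  shows "U = V"
proof -
  have "inj_on (\<lambda>x. restrict (h x) T) T"
    using T_invertible by (simp add: invertible_form_def bij_betw_def)
  moreover have "restrict (h U) T = restrict (h V) T"
    using assms(3) by (auto simp: restrict_def fun_eq_iff)
  ultimately show ?thesis
    using assms(1,2) by (auto dest: inj_onD)
qed

text \<open>For an arbitrary \<open>U\<close>, pairing with \<open>U\<close> restricts to a
  functional on \<open>T\<close>; surjectivity onto the dual represents it by an element of
  \<open>T\<close>.\<close>

lemma ex_proj: "\<exists>V\<in>T. \<forall>W\<in>T. h V W = h U W"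
proof -
  have "restrict (h U) T \<in> right_dual vec_act T"
    by (simp add: right_dual_def right_hom_def T_add T_vec_act h0_add_right h0_vec_act_right)
  then have "restrict (h U) T \<in> (\<lambda>x. restrict (h x) T) ` T"
    using T_invertible by (simp add: invertible_form_def bij_betw_def)
  then obtain V where V: "V \<in> T" "restrict (h V) T = restrict (h U) T"
    by auto
  then have "\<forall>W\<in>T. h V W = h U W"
    by (metis restrict_apply')
  with V(1) show ?thesis by blast
qed

text \<open>The choice is harmless: \<open>tangent_eqI\<close> leaves only one such
  \<open>V\<close>.\<close>

definition proj :: "(nat \<Rightarrow> 'a) \<Rightarrow> nat \<Rightarrow> 'a" where
  "proj U = (SOME V. V \<in> T \<and> (\<forall>W\<in>T. h V W = h U W))"

lemma proj_in_T: "proj U \<in> T"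
  and h_proj_left: "W \<in> T \<Longrightarrow> h (proj U) W = h U W"
  using someI_ex[OF ex_proj[of U, unfolded Bex_def]] by (auto simp: proj_def)

lemma h_proj_right: "W \<in> T \<Longrightarrow> h W (proj U) = h W U"
  using h_proj_left[of W U] star_h0[of n "proj U" W] star_h0[of n U W] by simp

lemma proj_eqI: "V \<in> T \<Longrightarrow> (\<And>W. W \<in> T \<Longrightarrow> h V W = h U W) \<Longrightarrow> proj U = V"
  by (rule tangent_eqI) (auto simp: proj_in_T h_proj_left)

text \<open>Hermitian symmetry moves the hypothesis to the first argument, where pairings with
  \<open>T\<close> determine \<open>proj\<close>.\<close>

lemma proj_cong: "(\<And>W. W \<in> T \<Longrightarrow> h W U = h W V) \<Longrightarrow> proj U = proj V"
  by (rule proj_eqI) (auto simp: proj_in_T h_proj_left star_h0[of n _ U, symmetric] star_h0[of n _ V, symmetric])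

lemma proj_ident: "U \<in> T \<Longrightarrow> proj U = U"
  by (rule proj_eqI) auto

lemma proj_add: "proj (U + V) = proj U + proj V"
  by (rule proj_eqI) (auto simp: proj_in_T T_add h_proj_left h0_add_left)

lemma proj_vec_act: "proj (U \<cdot> a) = proj U \<cdot> a"
  by (rule proj_eqI) (auto simp: proj_in_T T_vec_act h_proj_left h0_vec_act_left)

lemma proj_scale: "proj (fun_scale scale c U) = fun_scale scale c (proj U)"
  by (simp add: fun_scale_eq_vec_act proj_vec_act)

lemma proj_zero: "proj 0 = 0"
  using proj_add[of 0 0] by simp

lemma proj_diff: "proj (U - V) = proj U - proj V"
  using proj_add[of "U - V" V] by simp

lemma proj_sum: "proj (\<Sum>b\<in>B. U b) = (\<Sum>b\<in>B. proj (U b))"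
  using sum_comp_morphism[of "proj" U B, OF proj_zero proj_add]
  by (simp add: comp_def)

section \<open>Levi-Civita connections from matrices depending on the derivation\<close>

definition nabla_of ::
    "(('a \<Rightarrow> 'a) \<Rightarrow> nat \<Rightarrow> nat \<Rightarrow> 'a) \<Rightarrow> ('a \<Rightarrow> 'a) \<Rightarrow> (nat \<Rightarrow> 'a) \<Rightarrow> nat \<Rightarrow> 'a" where
  "nabla_of G d U = proj ((d \<circ> U) + fun_scale scale \<i> (mat_act n (G d) U))"

lemma linear_in_derivation_nabla_of:
  assumes "\<And>d1 d2 i j. d1 \<in> g \<Longrightarrow> d2 \<in> g \<Longrightarrow> G (d1 + d2) i j = G d1 i j + G d2 i j"
    and "\<And>c d i j. d \<in> g \<Longrightarrow> G (fun_scale scale c d) i j = scale c (G d i j)"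
  shows "linear_in_derivation scale g n X (nabla_of G)"
  unfolding linear_in_derivation_def
proof (intro conjI ballI allI)
  fix d1 d2 and U :: "nat \<Rightarrow> 'a"
  assume d: "d1 \<in> g" "d2 \<in> g"
  have "G (d1 + d2) = (\<lambda>i j. G d1 i j + G d2 i j)"
    using assms(1)[OF d] by (simp add: fun_eq_iff)
  moreover have "(d1 + d2) \<circ> U = (d1 \<circ> U) + (d2 \<circ> U)"
    by (simp add: fun_eq_iff)
  ultimately show "nabla_of G (d1 + d2) U = nabla_of G d1 U + nabla_of G d2 U"
    by (simp add: nabla_of_def mat_act_add_left fun_scale_add proj_add add_ac)
next
  fix c d and U :: "nat \<Rightarrow> 'a"
  assume d: "d \<in> g"
  have "G (fun_scale scale c d) = (\<lambda>i j. scale c (G d i j))"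
    using assms(2)[OF d] by (simp add: fun_eq_iff)
  moreover have "fun_scale scale c d \<circ> U = fun_scale scale c (d \<circ> U)"
    by (simp add: fun_eq_iff fun_scale_def)
  ultimately show "nabla_of G (fun_scale scale c d) U = fun_scale scale c (nabla_of G d U)"
    by (simp add: nabla_of_def mat_act_scale_left fun_scale_add proj_add proj_scale mult.commute)
qed

text \<open>The extra term \<open>U \<cdot> d a\<close> of the componentwise Leibniz rule already
  lies in \<open>T\<close>, so the projection fixes it.\<close>

lemma nabla_of_vec_act:
  assumes "d \<in> g" "U \<in> T"
  shows "nabla_of G d (U \<cdot> a) = nabla_of G d U \<cdot> a + U \<cdot> d a"
  using proj_ident[OF T_vec_act[OF assms(2)]]
  by (simp add: nabla_of_def comp_vec_act[OF assms(1)] mat_act_vec_act vec_act_fun_scale[symmetric]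
      proj_add proj_vec_act vec_act_add_left add_ac)

lemma nabla_of_add: "d \<in> g \<Longrightarrow> nabla_of G d (U + V) = nabla_of G d U + nabla_of G d V"
  by (simp add: nabla_of_def comp_add_right mat_act_add_right fun_scale_add proj_add add_ac)

lemma hermitian_connection_nabla_of:
  assumes "\<And>d i j. d \<in> g \<Longrightarrow> i \<in> {1..n} \<Longrightarrow> j \<in> {1..n} \<Longrightarrow> star (G (der_star star d) i j) = G d j i"
  shows "hermitian_connection star g n X (nabla_of G)"
  unfolding hermitian_connection_def
proof (intro ballI)
  fix d U V
  assume d: "d \<in> g" and U: "U \<in> T" and V: "V \<in> T"
  have "h (mat_act n (G (der_star star d)) U) V = h U (mat_act n (G d) V)"
    by (rule h0_mat_act_adjoint) (use assms[OF d] in auto)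
  then show "d (h U V) = h (nabla_of G (der_star star d) U) V + h U (nabla_of G d V)"
    \<comment> \<open>The projections drop out against \<open>U\<close> and \<open>V\<close> in
      \<open>T\<close>. The two matrix terms carry \<open>cnj \<i> = - \<i>\<close> and
      \<open>\<i>\<close>, so they cancel.\<close>
    by (simp add: nabla_of_def h_proj_left[OF V] h_proj_right[OF U] h0_add_left h0_add_right
        h0_scale_left h0_scale_right h0_derivation[OF d])
qed

lemma torsion_free_nabla_of:
  assumes "\<And>d1 d2. d1 \<in> g \<Longrightarrow> d2 \<in> g \<Longrightarrow>
      proj (mat_act n (G d1) (phi n X d2)) = proj (mat_act n (G d2) (phi n X d1))"
  shows "torsion_free g n X (nabla_of G)"
  unfolding torsion_free_def
proof (intro ballI)
  fix d1 d2
  assume d: "d1 \<in> g" "d2 \<in> g"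
  \<comment> \<open>The projected matrix terms cancel by symmetry; what remains is the projection of
    a vector equal to \<open>phi\<close> of the bracket, which lies in \<open>T\<close>.\<close>
  have "nabla_of G d1 (phi n X d2) - nabla_of G d2 (phi n X d1)
      = proj ((d1 \<circ> phi n X d2) - (d2 \<circ> phi n X d1))"
    using assms[OF d] by (simp add: nabla_of_def proj_add proj_scale proj_diff)
  also have "\<dots> = phi n X (lie_bracket d1 d2)"
    using proj_ident[OF phi_in_T[OF bracket_closed[OF d]]] by (simp add: phi_lie_bracket[OF d])
  finally show "nabla_of G d1 (phi n X d2) - nabla_of G d2 (phi n X d1)
      = phi n X (lie_bracket d1 d2)" .
qed

lemma levi_civita_nabla_of:
  assumes "\<And>d1 d2 i j. d1 \<in> g \<Longrightarrow> d2 \<in> g \<Longrightarrow> G (d1 + d2) i j = G d1 i j + G d2 i j"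
    and "\<And>c d i j. d \<in> g \<Longrightarrow> G (fun_scale scale c d) i j = scale c (G d i j)"
    and "\<And>d i j. d \<in> g \<Longrightarrow> i \<in> {1..n} \<Longrightarrow> j \<in> {1..n} \<Longrightarrow> star (G (der_star star d) i j) = G d j i"
    and "\<And>d1 d2. d1 \<in> g \<Longrightarrow> d2 \<in> g \<Longrightarrow>
      proj (mat_act n (G d1) (phi n X d2)) = proj (mat_act n (G d2) (phi n X d1))"
  shows "levi_civita scale star g n X (nabla_of G)"
  unfolding levi_civita_def connection_def
  using linear_in_derivation_nabla_of[of G, OF assms(1,2)]
    hermitian_connection_nabla_of[of G, OF assms(3)] torsion_free_nabla_of[of G, OF assms(4)]
    nabla_of_vec_act nabla_of_add proj_in_T
  by (simp add: nabla_of_def)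

lemma levi_civita_exists: "\<exists>nabla. levi_civita scale star g n X nabla"
  \<comment> \<open>The zero matrices satisfy all four conditions, giving the projected
    componentwise derivative.\<close>
  using levi_civita_nabla_of[of "\<lambda>_ _ _. 0"] by (auto simp: star_zero mat_act_def)

section \<open>Generators of the tangent module and the explicit formula\<close>

lemma tangent_generated:
  assumes "hermitian_basis scale star g m D" "U \<in> T"
  shows "\<exists>\<mu>. U = (\<Sum>b=1..m. phi n X (D b) \<cdot> \<mu> b)"
proof -
  \<comment> \<open>\<open>S\<close> will be shown to be a right submodule of the free module that
    contains the image of \<open>phi\<close> on \<open>g\<close>, so that it contains the hull
    \<open>T\<close>.\<close>
  define S where "S = range (\<lambda>\<mu>. \<Sum>b=1..m. phi n X (D b) \<cdot> \<mu> b)"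
  have S_add: "U + V \<in> S" if "U \<in> S" "V \<in> S" for U V
  proof -
    from that obtain \<mu> \<nu> where "U = (\<Sum>b=1..m. phi n X (D b) \<cdot> \<mu> b)"
      "V = (\<Sum>b=1..m. phi n X (D b) \<cdot> \<nu> b)" by (auto simp: S_def)
    then have "U + V = (\<Sum>b=1..m. phi n X (D b) \<cdot> (\<mu> b + \<nu> b))"
      by (simp add: vec_act_add_right sum.distrib)
    then show ?thesis by (auto simp: S_def)
  qed
  have S_act: "U \<cdot> a \<in> S" if "U \<in> S" for U a
  proof -
    from that obtain \<mu> where "U = (\<Sum>b=1..m. phi n X (D b) \<cdot> \<mu> b)" by (auto simp: S_def)
    then have "U \<cdot> a = (\<Sum>b=1..m. phi n X (D b) \<cdot> (\<mu> b * a))"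
      by (simp add: vec_act_sum_left vec_act_assoc)
    then show ?thesis by (auto simp: S_def)
  qed
  have S_zero: "0 \<in> S"
  proof -
    have "0 = (\<Sum>b=1..m. phi n X (D b) \<cdot> 0)" by (simp add: vec_act_def fun_eq_iff sum_fun_apply)
    then show ?thesis by (auto simp: S_def)
  qed
  have S_scale: "fun_scale scale c U \<in> S" if "U \<in> S" for c U
    using S_act[OF that] by (simp add: fun_scale_eq_vec_act)
  have S_minus: "- U \<in> S" if "U \<in> S" for U
    using S_act[OF that, of "- 1"] by (simp add: vec_act_def fun_Compl_def)
  have "phi n X (D a) \<in> S" if "a \<in> {1..m}" for a
  proof -
    \<comment> \<open>Kronecker delta coefficients single out one generator.\<close>
    have "(\<Sum>b=1..m. phi n X (D b) \<cdot> (if b = a then 1 else 0))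
        = (\<Sum>b=1..m. if b = a then phi n X (D b) else 0)"
      by (rule sum.cong) (auto simp: vec_act_def fun_eq_iff)
    also have "\<dots> = phi n X (D a)" using that by simp
    finally show ?thesis unfolding S_def by (metis rangeI)
  qed
  moreover have "phi n X 0 \<in> S"
    using S_zero by (simp add: phi_def zero_fun_def)
  \<comment> \<open>Basis induction passes from the generators to all of \<open>g\<close>, as
    \<open>S\<close> is closed under sums and complex scaling.\<close>
  ultimately have phi_S: "phi n X d \<in> S" if "d \<in> g" for d
    using hermitian_basis_induct[OF assms(1) that, where P = "\<lambda>d. phi n X d \<in> S"]
    by (simp add: phi_add phi_scale S_add S_scale)
  have free: "S \<subseteq> free_module {1..n}"
  proof
    fix U assume "U \<in> S"
    then obtain \<mu> where \<mu>: "U = (\<Sum>b=1..m. phi n X (D b) \<cdot> \<mu> b)" by (auto simp: S_def)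
    show "U \<in> free_module {1..n}"
      unfolding \<mu> by (auto simp: free_module_finite sum_fun_apply vec_act_def phi_def intro!: sum.neutral)
  qed
  have "right_submodule vec_act (free_module {1..n}) S"
    unfolding right_submodule_def right_module_def
    using free S_zero S_add S_minus S_act
    by (auto simp: vec_act_add_left vec_act_add_right vec_act_assoc)
      (simp add: vec_act_def)
  then have "T \<subseteq> S"
    unfolding tangent_def by (intro hull_minimal) (use phi_S in auto)
  then show ?thesis using assms(2) by (auto simp: S_def)
qed

text \<open>Since each \<open>e p\<close> lies in \<open>T\<close>, \<open>U\<close> may be replaced
  by \<open>proj U\<close> in the pairings. Expanding \<open>proj U\<close> in the generators then
  leaves sums that the defining property of \<open>hinv\<close> collapses.\<close>

lemma proj_eq_metric_inverse:
  assumes basis: "hermitian_basis scale star g m D"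
    and e: "\<And>a. e a = phi n X (D a)"
    and inverse: "metric_inverse star n m e hinv"
  shows "proj U = (\<Sum>c=1..m. \<Sum>p=1..m. e c \<cdot> (hinv c p * h (e p) U))"
proof -
  have e_T: "e p \<in> T" if "p \<in> {1..m}" for p
    using that by (simp add: e phi_in_T hermitian_basis_in[OF basis])
  obtain \<mu> where \<mu>: "proj U = (\<Sum>b=1..m. e b \<cdot> \<mu> b)"
    using tangent_generated[OF basis proj_in_T] by (auto simp: e)
  have "(\<Sum>c=1..m. \<Sum>p=1..m. e c \<cdot> (hinv c p * h (e p) U))
      = (\<Sum>c=1..m. \<Sum>p=1..m. e c \<cdot> (hinv c p * h (e p) (proj U)))"
    by (intro sum.cong refl) (simp add: h_proj_right e_T)
  also have "\<dots> = (\<Sum>c=1..m. \<Sum>p=1..m. \<Sum>b=1..m. e c \<cdot> (hinv c p * h (e p) (e b)) \<cdot> \<mu> b)"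
    by (simp add: \<mu> h0_sum_right h0_vec_act_right sum_distrib_left vec_act_sum_right vec_act_assoc
        mult.assoc)
  also have "\<dots> = (\<Sum>c=1..m. \<Sum>b=1..m. \<Sum>p=1..m. e c \<cdot> (hinv c p * h (e p) (e b)) \<cdot> \<mu> b)"
    by (intro sum.cong refl sum.swap)
  also have "\<dots> = (\<Sum>b=1..m. \<Sum>c=1..m. \<Sum>p=1..m. e c \<cdot> (hinv c p * h (e p) (e b)) \<cdot> \<mu> b)"
    by (rule sum.swap)
  also have "\<dots> = (\<Sum>b=1..m. (\<Sum>c=1..m. \<Sum>p=1..m. e c \<cdot> (hinv c p * h (e p) (e b))) \<cdot> \<mu> b)"
    by (simp add: vec_act_sum_left)
  also have "\<dots> = proj U"
    using inverse by (simp add: \<mu> metric_inverse_def)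
  finally show ?thesis ..
qed

lemma connection_formula_nabla_of:
  assumes basis: "hermitian_basis scale star g m D"
    and e: "\<And>a. e a = phi n X (D a)"
    and inverse: "metric_inverse star n m e hinv"
    and G: "\<And>a. a \<in> {1..m} \<Longrightarrow> G (D a) = \<gamma> a"
  shows "connection_formula scale star n m D e hinv \<gamma> (nabla_of G)"
  unfolding connection_formula_def
proof (intro ballI allI)
  fix a \<mu> assume a: "a \<in> {1..m}"
  have D: "D a \<in> g" by (rule hermitian_basis_in[OF basis a])
  have e_T: "e p \<in> T" if "p \<in> {1..m}" for p
    using that by (simp add: e phi_in_T hermitian_basis_in[OF basis])
  let ?w = "\<lambda>b. (D a \<circ> e b) + fun_scale scale \<i> (mat_act n (\<gamma> a) (e b))"
  have "(D a \<circ> (\<Sum>b=1..m. e b \<cdot> \<mu> b)) + fun_scale scale \<i> (mat_act n (\<gamma> a) (\<Sum>b=1..m. e b \<cdot> \<mu> b))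
      = (\<Sum>b=1..m. e b \<cdot> D a (\<mu> b)) + (\<Sum>b=1..m. ?w b \<cdot> \<mu> b)"
    by (simp add: comp_sum[OF D] comp_vec_act[OF D] mat_act_sum_right mat_act_vec_act
        pw.scale_sum_right vec_act_add_left vec_act_fun_scale sum.distrib add_ac)
  \<comment> \<open>The projection commutes with sums and the right action, so the coefficients
    \<open>\<mu> b\<close> come out of the second sum.\<close>
  then have "nabla_of G (D a) (\<Sum>b=1..m. e b \<cdot> \<mu> b)
      = (\<Sum>b=1..m. proj (e b \<cdot> D a (\<mu> b))) + (\<Sum>b=1..m. proj (?w b) \<cdot> \<mu> b)"
    by (simp only: nabla_of_def G[OF a] proj_add[of "sum _ _"] proj_sum proj_vec_act)
  also have "(\<Sum>b=1..m. proj (e b \<cdot> D a (\<mu> b))) = (\<Sum>b=1..m. e b \<cdot> D a (\<mu> b))"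
    by (intro sum.cong refl proj_ident T_vec_act e_T)
  also have "(\<Sum>b=1..m. proj (?w b) \<cdot> \<mu> b) = (\<Sum>b=1..m. \<Sum>c=1..m. \<Sum>p=1..m.
      e c \<cdot> (hinv c p * (h (e p) (D a \<circ> e b) + scale \<i> (gamma_comp star n e \<gamma> a p b)) * \<mu> b))"
    by (simp add: proj_eq_metric_inverse[OF basis e inverse] vec_act_sum_left vec_act_assoc
        h0_add_right h0_scale_right gamma_comp_eq_h0)
  finally show "nabla_of G (D a) (\<Sum>b=1..m. e b \<cdot> \<mu> b) = (\<Sum>b=1..m. e b \<cdot> D a (\<mu> b)) +
      (\<Sum>b=1..m. \<Sum>c=1..m. \<Sum>p=1..m.
      e c \<cdot> (hinv c p * (h (e p) (D a \<circ> e b) + scale \<i> (gamma_comp star n e \<gamma> a p b)) * \<mu> b))" .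
qed

text \<open>The formula fixes the values at basis derivations on all of \<open>T\<close>, because
  every element of \<open>T\<close> is a combination of the generators; linearity in the derivation
  fixes the rest.\<close>

lemma connection_formula_unique:
  assumes basis: "hermitian_basis scale star g m D"
    and e: "\<And>a. e a = phi n X (D a)"
    and lin: "linear_in_derivation scale g n X nabla" "linear_in_derivation scale g n X nabla'"
    and formula: "connection_formula scale star n m D e hinv \<gamma> nabla"
      "connection_formula scale star n m D e hinv \<gamma> nabla'"
    and "d \<in> g" "U \<in> T"
  shows "nabla' d U = nabla d U"
proof (rule hermitian_basis_induct[OF basis \<open>d \<in> g\<close>])
  have "N 0 U = 0" if "linear_in_derivation scale g n X N" for N
  proof -
    \<comment> \<open>Scaling by 0 yields the value at the zero derivation, the base case of the
      induction.\<close>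
    have "N (fun_scale scale 0 0) U = fun_scale scale 0 (N 0 U)"
      using that zero_in_g \<open>U \<in> T\<close> unfolding linear_in_derivation_def by blast
    then show ?thesis by simp
  qed
  with lin show "nabla' 0 U = nabla 0 U" by simp
next
  fix x y
  assume "x \<in> g" "y \<in> g" "nabla' x U = nabla x U" "nabla' y U = nabla y U"
  then show "nabla' (x + y) U = nabla (x + y) U"
    using lin \<open>U \<in> T\<close> by (simp add: linear_in_derivation_def)
next
  fix c x
  assume "x \<in> g" "nabla' x U = nabla x U"
  then show "nabla' (fun_scale scale c x) U = nabla (fun_scale scale c x) U"
    using lin \<open>U \<in> T\<close> by (simp add: linear_in_derivation_def)
next
  fix a assume "a \<in> {1..m}"
  moreover obtain \<mu> where "U = (\<Sum>b=1..m. e b \<cdot> \<mu> b)"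
    using tangent_generated[OF basis \<open>U \<in> T\<close>] by (auto simp: e)
  ultimately show "nabla' (D a) U = nabla (D a) U"
    using formula by (simp add: connection_formula_def)
qed

section \<open>Extending \<gamma> linearly from the basis and transferring its conditions\<close>

lemma linear_extension_of_matrices:
  assumes "hermitian_basis scale star g m D"
  obtains G :: "('a \<Rightarrow> 'a) \<Rightarrow> nat \<Rightarrow> nat \<Rightarrow> 'a"
  where "\<And>d1 d2 i j. G (d1 + d2) i j = G d1 i j + G d2 i j"
    and "\<And>c d i j. G (fun_scale scale c d) i j = scale c (G d i j)"
    and "\<And>a. a \<in> {1..m} \<Longrightarrow> G (D a) = \<gamma> a"
proof -
  \<comment> \<open>Matrices are uncurried to functions on pairs of indices, so that
    \<open>fun_scale\<close> gives them a vector space structure.\<close>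
  interpret pair: vector_space_pair "fun_scale scale :: complex \<Rightarrow> ('a \<Rightarrow> 'a) \<Rightarrow> 'a \<Rightarrow> 'a"
    "fun_scale scale :: complex \<Rightarrow> (nat \<times> nat \<Rightarrow> 'a) \<Rightarrow> nat \<times> nat \<Rightarrow> 'a"
    by unfold_locales
  have inj: "inj_on D {1..m}" and indep: "\<not> pw.dependent (D ` {1..m})"
    using assms by (auto simp: hermitian_basis_def)
  \<comment> \<open>The basis is a set of derivations, so \<open>inv_into\<close> recovers the
    index, unambiguously by injectivity of \<open>D\<close>. The extension \<open>F\<close> is
    linear on the whole function space, not only on \<open>g\<close>.\<close>
  obtain F where F: "Vector_Spaces.linear (fun_scale scale) (fun_scale scale) F"
    and FD: "\<forall>x\<in>D ` {1..m}. F x = (\<lambda>(i, j). \<gamma> (inv_into {1..m} D x) i j)"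
    using pair.linear_independent_extend[OF indep,
        of "\<lambda>x (i, j). \<gamma> (inv_into {1..m} D x) i j"]
    by blast
  interpret F: Vector_Spaces.linear "fun_scale scale" "fun_scale scale" F by (rule F)
  show ?thesis
  proof
    show "F (d1 + d2) (i, j) = F d1 (i, j) + F d2 (i, j)" for d1 d2 i j
      by (simp add: F.add)
    show "F (fun_scale scale c d) (i, j) = scale c (F d (i, j))" for c d i j
      by (simp add: F.scale fun_scale_def[of _ c "F d"])
    show "(\<lambda>i j. F (D a) (i, j)) = \<gamma> a" if "a \<in> {1..m}" for a
      using that FD inj by simp
  qed
qed

text \<open>Pairings with the generators determine pairings with all of \<open>T\<close>, by
  conjugate linearity in the first argument.\<close>

lemma proj_cong_basis:
  assumes basis: "hermitian_basis scale star g m D"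
    and "\<And>p. p \<in> {1..m} \<Longrightarrow> h (phi n X (D p)) U = h (phi n X (D p)) V"
  shows "proj U = proj V"
proof (rule proj_cong)
  fix W assume "W \<in> T"
  then obtain \<mu> where "W = (\<Sum>b=1..m. phi n X (D b) \<cdot> \<mu> b)"
    using tangent_generated[OF basis] by blast
  then show "h W U = h W V"
    using assms(2) by (simp add: h0_sum_left h0_vec_act_left)
qed

text \<open>Both conditions on \<gamma> are read off at basis derivations and propagate to
  \<open>g\<close> by linearity.\<close>

lemma levi_civita_of_matrices:
  assumes basis: "hermitian_basis scale star g m D"
    and e: "\<And>a. e a = phi n X (D a)"
    and hermitian: "\<forall>a\<in>{1..m}. \<forall>i\<in>{1..n}. \<forall>j\<in>{1..n}. star (\<gamma> a i j) = \<gamma> a j i"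
    and symmetric: "\<forall>a\<in>{1..m}. \<forall>b\<in>{1..m}. \<forall>c\<in>{1..m}.
      gamma_comp star n e \<gamma> a b c = gamma_comp star n e \<gamma> c b a"
    and G_add: "\<And>d1 d2 i j. G (d1 + d2) i j = G d1 i j + G d2 i j"
    and G_scale: "\<And>c d i j. G (fun_scale scale c d) i j = scale c (G d i j)"
    and G_basis: "\<And>a. a \<in> {1..m} \<Longrightarrow> G (D a) = \<gamma> a"
  shows "levi_civita scale star g n X (nabla_of G)"
proof (rule levi_civita_nabla_of)
  have G0: "G 0 i j = 0" for i j
    using G_add[of 0 0 i j] by simp
  have der_star_0: "der_star star 0 = 0"
    by (simp add: der_star_def fun_eq_iff star_zero)
  have mat_add: "mat_act n (G (x + y)) U = mat_act n (G x) U + mat_act n (G y) U" for x y U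
    using mat_act_add_left[of n "G x" "G y" U] by (simp add: G_add mat_act_def)
  have mat_scale: "mat_act n (G (fun_scale scale c x)) U = fun_scale scale c (mat_act n (G x) U)"
    for c x U
    using mat_act_scale_left[of n c "G x" U] by (simp add: G_scale mat_act_def)
  have mat_0: "mat_act n (G 0) U = 0" for U
    by (simp add: mat_act_def G0 fun_eq_iff)
  have phi_0: "phi n X 0 = 0"
    by (simp add: phi_def fun_eq_iff)
  show "star (G (der_star star d) i j) = G d j i" if "d \<in> g" "i \<in> {1..n}" "j \<in> {1..n}" for d i j
  \<comment> \<open>Both sides are complex linear in \<open>d\<close>, the conjugations from
    \<open>star\<close> and \<open>der_star\<close> cancelling; at \<open>D a\<close> the derivation
    is hermitian.\<close>
  proof (rule hermitian_basis_induct[OF basis \<open>d \<in> g\<close>,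
        where P = "\<lambda>d. star (G (der_star star d) i j) = G d j i"])
    show "star (G (der_star star (D a)) i j) = G (D a) j i" if "a \<in> {1..m}" for a
      using basis hermitian that \<open>i \<in> {1..n}\<close> \<open>j \<in> {1..n}\<close>
      by (simp add: hermitian_basis_def G_basis)
  qed (simp_all add: der_star_0 G0 star_zero der_star_add der_star_fun_scale G_add G_scale
      star_add star_scale)
  let ?sym = "\<lambda>d1 d2. proj (mat_act n (G d1) (phi n X d2)) = proj (mat_act n (G d2) (phi n X d1))"
  \<comment> \<open>Paired with a generator \<open>e p\<close>, this is the symmetry of
    \<open>gamma_comp\<close> in its first and third indices. Both sides are bilinear in the
    derivations, so two basis inductions, one per argument, extend it to \<open>g\<close>.\<close>
  have *: "?sym (D a) (D b)" if "a \<in> {1..m}" "b \<in> {1..m}" for a b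
    by (rule proj_cong_basis[OF basis])
      (use that symmetric in \<open>simp add: G_basis gamma_comp_eq_h0 e\<close>)
  have **: "?sym d (D b)" if "d \<in> g" "b \<in> {1..m}" for d b
    by (rule hermitian_basis_induct[OF basis \<open>d \<in> g\<close>, where P = "\<lambda>d. ?sym d (D b)"])
      (use * that in \<open>simp_all add: mat_add mat_scale mat_0 phi_0 phi_add phi_scale
        mat_act_zero_right mat_act_add_right mat_act_fun_scale proj_add proj_scale\<close>)
  show "?sym d1 d2" if "d1 \<in> g" "d2 \<in> g" for d1 d2
    by (rule hermitian_basis_induct[OF basis \<open>d2 \<in> g\<close>, where P = "\<lambda>d. ?sym d1 d"])
      (use ** that in \<open>simp_all add: mat_add mat_scale mat_0 phi_0 phi_add phi_scale
        mat_act_zero_right mat_act_add_right mat_act_fun_scale proj_add proj_scale\<close>)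
qed (use G_add G_scale in auto)

end

text \<open>That the formula defines a connection is expressed as existence together with uniqueness
  on \<open>g\<close> and \<open>T\<close>. As the formula is imposed for every coefficient family
  \<mu>, existence includes independence of the chosen representation by generators.\<close>

theorem theorem4p6:
  fixes scale :: "complex \<Rightarrow> 'a::{ring,monoid_mult} \<Rightarrow> 'a"
    and star :: "'a \<Rightarrow> 'a"
    and g :: "('a \<Rightarrow> 'a) set"
    and n :: nat
    and X :: "nat \<Rightarrow> 'a"
  assumes "embedded_manifold scale star g n X"
    and "regular_manifold star g n X"
  shows
    "(\<forall>(m::nat) (D :: nat \<Rightarrow> 'a \<Rightarrow> 'a) (e :: nat \<Rightarrow> nat \<Rightarrow> 'a)
        (hinv :: nat \<Rightarrow> nat \<Rightarrow> 'a) (\<gamma> :: nat \<Rightarrow> nat \<Rightarrow> nat \<Rightarrow> 'a).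
        hermitian_basis scale star g m D \<and>
        (\<forall>a. e a = phi n X (D a)) \<and>
        metric_inverse star n m e hinv \<and>
        (\<forall>a\<in>{1..m}. \<forall>i\<in>{1..n}. \<forall>j\<in>{1..n}. star (\<gamma> a i j) = \<gamma> a j i) \<and>
        (\<forall>a\<in>{1..m}. \<forall>b\<in>{1..m}. \<forall>c\<in>{1..m}.
           gamma_comp star n e \<gamma> a b c = gamma_comp star n e \<gamma> c b a) \<longrightarrow>
        (\<exists>nabla.
           linear_in_derivation scale g n X nabla \<and>
           connection_formula scale star n m D e hinv \<gamma> nabla \<and>
           levi_civita scale star g n X nabla \<and>
           (\<forall>nabla'. linear_in_derivation scale g n X nabla' \<and>
                     connection_formula scale star n m D e hinv \<gamma> nabla' \<longrightarrow>
                     (\<forall>d\<in>g. \<forall>U\<in>tangent g n X. nabla' d U = nabla d U))))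
     \<and> (\<exists>nabla. levi_civita scale star g n X nabla)"
proof -
  interpret embedded_manifold scale star g n X by fact
  interpret regular_embedded_manifold scale star g n X by unfold_locales fact
  show ?thesis
  proof (intro conjI allI impI; (elim conjE)?)
    show "\<exists>nabla. levi_civita scale star g n X nabla"
      by (rule levi_civita_exists)
  next
    fix m D e hinv \<gamma>
    assume basis: "hermitian_basis scale star g m D"
      and "\<forall>a. e a = phi n X (D a)"
      and inverse: "metric_inverse star n m e hinv"
      and hermitian: "\<forall>a\<in>{1..m}. \<forall>i\<in>{1..n}. \<forall>j\<in>{1..n}. star (\<gamma> a i j) = \<gamma> a j i"
      and symmetric: "\<forall>a\<in>{1..m}. \<forall>b\<in>{1..m}. \<forall>c\<in>{1..m}.
        gamma_comp star n e \<gamma> a b c = gamma_comp star n e \<gamma> c b a"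
    then have e: "e a = phi n X (D a)" for a
      by (elim allE)
    \<comment> \<open>\<open>G\<close> is the linear extension of \<gamma>, and
      \<open>nabla_of G\<close> is the witness for the connection.\<close>
    obtain G where G: "\<And>d1 d2 i j. G (d1 + d2) i j = G d1 i j + G d2 i j"
      "\<And>c d i j. G (fun_scale scale c d) i j = scale c (G d i j)"
      "\<And>a. a \<in> {1..m} \<Longrightarrow> G (D a) = \<gamma> a"
      by (rule linear_extension_of_matrices[OF basis, where \<gamma> = \<gamma>]) (rule that)
    have lc: "levi_civita scale star g n X (nabla_of G)"
      by (rule levi_civita_of_matrices[where D = D and e = e and \<gamma> = \<gamma> and G = G,
            OF basis e hermitian symmetric G])
    then have lin: "linear_in_derivation scale g n X (nabla_of G)"
      by (simp add: levi_civita_def connection_def)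
    have formula: "connection_formula scale star n m D e hinv \<gamma> (nabla_of G)"
      by (rule connection_formula_nabla_of[where D = D and e = e and hinv = hinv
            and \<gamma> = \<gamma> and G = G, OF basis e inverse G(3)])
    show "\<exists>nabla.
           linear_in_derivation scale g n X nabla \<and>
           connection_formula scale star n m D e hinv \<gamma> nabla \<and>
           levi_civita scale star g n X nabla \<and>
           (\<forall>nabla'. linear_in_derivation scale g n X nabla' \<and>
                     connection_formula scale star n m D e hinv \<gamma> nabla' \<longrightarrow>
                     (\<forall>d\<in>g. \<forall>U\<in>T. nabla' d U = nabla d U))"
    proof (intro exI[of _ "nabla_of G"] conjI allI impI ballI lc lin formula; elim conjE)
      fix nabla' d U
      assume "linear_in_derivation scale g n X nabla'"
        "connection_formula scale star n m D e hinv \<gamma> nabla'" "d \<in> g" "U \<in> T"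
      then show "nabla' d U = nabla_of G d U"
        by (intro connection_formula_unique[where D = D and e = e and hinv = hinv and \<gamma> = \<gamma>
              and m = m and nabla = "nabla_of G" and nabla' = nabla' and d = d and U = U]
              basis e lin formula)
    qed
  qed
qed

end
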